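(* Let $p(z)=a_dz^d+\dots+a_1z+a_0\in\mathbb{Z}[z]$ with $d\ge 1$ and $a_d>0$. Then every 2-colouring of $\mathbb{N}$ has infinitely many monochromatic solutions to $x+y=p(z)$ if and only if $p(1)\cdot p(2)$ is even.
   Context: $\mathbb{N}=\{1,2,3,\dots\}$. A 2-colouring of $\mathbb{N}$ is a function $\phi:\mathbb{N}\to\{-1,1\}$. A monochromatic solution of $x+y=p(z)$ is a triple $(x,y,z)\in\mathbb{N}^3$ (not necessarily distinct entries) with $x+y=p(z)$ and $\phi(x)=\phi(y)=\phi(z)$. *)

theory Defs
  imports "HOL-Computational_Algebra.Polynomial" "HOL-Library.FuncSet"
begin

text \<open>
  The positive integers are the elements of \<^term>\<open>{1..} :: nat set\<close>. Values of a colouring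
  outside this set (that is, at \<open>0\<close>) are unconstrained and are never used.
\<close>

definition two_colouring :: "(nat \<Rightarrow> int) \<Rightarrow> bool" where
  "two_colouring \<phi> \<longleftrightarrow> \<phi> \<in> {1..} \<rightarrow> {-1, 1}"

definition mono_solutions :: "int poly \<Rightarrow> (nat \<Rightarrow> int) \<Rightarrow> (nat \<times> nat \<times> nat) set" where
  "mono_solutions p \<phi> =
     {(x, y, z). x \<in> {1..} \<and> y \<in> {1..} \<and> z \<in> {1..} \<and>
        int x + int y = poly p (int z) \<and> \<phi> x = \<phi> y \<and> \<phi> y = \<phi> z}"

end

theory Submission
  imports Defs "HOL-Number_Theory.Cong"
begin

text \<open>
  If \<open>p(1) p(2)\<close> is odd then \<open>p\<close> takes only odd values and the parity colouring has no
  monochromatic solution.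

  Otherwise suppose that a colouring has no monochromatic solution with \<open>z\<close> large. Then both
  colours recur forever, so there are arbitrarily large switches: places where \<open>z\<close> and \<open>z + 1\<close>
  differ in colour. Whenever \<open>s\<close> and \<open>t\<close> are large and of different colours, reflecting
  \<open>x\<close> to \<open>p(s) - x\<close> and then in \<open>p(t)\<close> shows that the colour of \<open>s\<close> is preserved by
  translation by \<open>p(t) - p(s)\<close>.

  Two switches \<open>z < w\<close> of opposite types with \<open>w \<le> 4 z\<close> give translations by \<open>a\<close> and
  \<open>-b\<close>, where \<open>a = p(z + 1) - p(z)\<close> and \<open>b = p(w + 1) - p(w)\<close>. Together they act on \<open>{1..a + b}\<close> as
  a rotation, so below \<open>p(z + 1)\<close> the colouring is periodic modulo \<open>g = gcd a b\<close>. As one of any two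
  consecutive values of \<open>p\<close> is even, \<open>p(z)\<close> or \<open>p(z) + g\<close> is even, and half of it,
  \<open>h\<close>, has the same colour as \<open>p(z) - h\<close> and \<open>p(z + 1) - h\<close>. Since \<open>z\<close> and
  \<open>z + 1\<close> have different colours, one of them completes a monochromatic solution.

  Hence the colouring is constant on \<open>[v/4, v]\<close> for every large switch \<open>v\<close>. For a large switch
  \<open>z\<close> and small \<open>x\<close>, \<open>y\<close> coloured like \<open>z\<close> and \<open>z + 1\<close>, the numbers
  \<open>p(z) - x\<close> and \<open>p(z + 1) - y\<close> have different colours, so there is a switch \<open>v\<close> between
  them. The constant block below \<open>v\<close> contains both halves of \<open>p(z)\<close> and of \<open>p(z + 1)\<close>, and its
  colour is that of \<open>z\<close> or of \<open>z + 1\<close>: again a monochromatic solution.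
\<close>

section \<open>Rotations of an interval and switches of a colouring\<close>

text \<open>The orbits of translation by \<open>a\<close> modulo \<open>a + b\<close> are the
  classes modulo \<open>gcd a (a + b)\<close>, which equals \<open>gcd a b\<close>.\<close>

lemma rotation_closed:
  fixes a b x y :: nat and S :: "nat set"
  assumes pos: "0 < a" "0 < b"
    and up: "\<And>x. x \<in> S \<Longrightarrow> 1 \<le> x \<Longrightarrow> x \<le> b \<Longrightarrow> x + a \<in> S"
    and down: "\<And>x. x \<in> S \<Longrightarrow> b < x \<Longrightarrow> x \<le> a + b \<Longrightarrow> x - b \<in> S"
    and x: "x \<in> S" "1 \<le> x" "x \<le> a + b"
    and y: "1 \<le> y" "y \<le> a + b"
    and xy: "[x = y] (mod gcd a b)"
  shows "y \<in> S"
proof -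
  txt \<open>The two moves together are translation by \<open>a\<close> modulo \<open>a + b\<close>.\<close>
  have orbit: "\<exists>t \<in> S. 1 \<le> t \<and> t \<le> a + b \<and> [t = x + k * a] (mod a + b)" for k
  proof (induction k)
    case 0
    then show ?case using x by auto
  next
    case (Suc k)
    then obtain t where t: "t \<in> S" "1 \<le> t" "t \<le> a + b" "[t = x + k * a] (mod a + b)"
      by blast
    have ta: "[t + a = x + Suc k * a] (mod a + b)"
      using cong_add[OF t(4) cong_refl[of a]] by (simp add: algebra_simps)
    show ?case
    proof (cases "t \<le> b")
      case True
      then show ?thesis using up[of t] t ta pos by (intro bexI[of _ "t + a"]) auto
    next
      case False
      have "t + a = (t - b) + (a + b)" using False by simp
      then have "[t - b = t + a] (mod a + b)" by (metis cong_def mod_add_self2)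
      then have "[t - b = x + Suc k * a] (mod a + b)" using ta cong_trans by blast
      then show ?thesis using down[of t] t False by (intro bexI[of _ "t - b"]) auto
    qed
  qed
  \<comment> \<open>Raising the target by \<open>a + b\<close> puts it above \<open>x\<close>, so
    the difference is a natural multiple of the gcd.\<close>
  have "[x = y + (a + b)] (mod gcd a b)"
    using cong_add[OF xy, of 0 "a + b"] by (simp add: cong_def mod_eq_0_iff_dvd)
  moreover have "x \<le> y + (a + b)" using x by simp
  ultimately obtain m where m: "y + (a + b) = x + m * gcd a b"
    by (auto simp: cong_sym_eq[of x] cong_le_nat add.commute)
  obtain k where "[a * k = gcd a (a + b)] (mod a + b)"
    using cong_solve_nat pos by (metis less_not_refl2)
  then have "[a * k * m = gcd a b * m] (mod a + b)"
    by (simp add: cong_scalar_right)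
  then have k: "[x + k * m * a = y + (a + b)] (mod a + b)"
    unfolding m by (intro cong_add cong_refl) (simp add: mult_ac)
  obtain t where t: "t \<in> S" "1 \<le> t" "t \<le> a + b" "[t = x + k * m * a] (mod a + b)"
    using orbit by blast
  have "[t = y] (mod a + b)"
    using cong_trans[OF t(4) k] by (simp add: cong_def)
  then have "[(t - 1) + 1 = (y - 1) + 1] (mod a + b)" using t y by simp
  then have "[t - 1 = y - 1] (mod a + b)" using cong_add_rcancel_nat by blast
  then have "t - 1 = y - 1"
    by (rule cong_less_modulus_unique_nat) (use t y in auto)
  then show ?thesis using t y by (metis le_add_diff_inverse)
qed

lemma switch_between:
  fixes \<chi> :: "nat \<Rightarrow> bool"
  assumes "m \<le> n" "\<chi> m \<noteq> \<chi> n"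
  shows "\<exists>u. m \<le> u \<and> u < n \<and> \<chi> u \<noteq> \<chi> n \<and> \<chi> (Suc u) = \<chi> n"
  using assms
proof (induction rule: inc_induct)
  case (step k)
  then show ?case
    by (cases "\<chi> (Suc k) = \<chi> n") (auto intro: exI[of _ k] dest: Suc_leD)
qed simp

section \<open>Colourings without large monochromatic solutions\<close>

text \<open>Collects what the combinatorial argument takes from the polynomial. A Boolean
  \<open>\<chi>\<close> makes two colours that differ from a third agree.\<close>

locale solution_free =
  fixes \<chi> :: "nat \<Rightarrow> bool" and f :: "nat \<Rightarrow> nat" and L :: nat
  assumes free: "\<lbrakk>L \<le> z; 1 \<le> x; 1 \<le> y; x + y = f z; \<chi> x = \<chi> z; \<chi> y = \<chi> z\<rbrakk> \<Longrightarrow> False"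
    and incr: "L \<le> n \<Longrightarrow> f n < f (Suc n)"
    and slow: "\<lbrakk>L \<le> u; u \<le> v; v \<le> 4 * u\<rbrakk> \<Longrightarrow> 2 * (f (Suc v) - f v) < f u"
    and parity: "L \<le> n \<Longrightarrow> even (f n) \<or> even (f (Suc n))"
begin

lemma f_less: "L \<le> m \<Longrightarrow> m < n \<Longrightarrow> f m < f n"
  by (rule less_Suc_induct[of m n "\<lambda>m n. L \<le> m \<longrightarrow> f m < f n", THEN mp]) (auto intro: incr)

lemma le_iterate: "n \<le> f (L + n)"
proof (induction n)
  case (Suc n)
  then show ?case using incr[of "L + n"] by simp
qed simp

lemma flip:
  assumes "L \<le> z" "1 \<le> x" "x < f z" "\<chi> x = \<chi> z"
  shows "\<chi> (f z - x) \<noteq> \<chi> z"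
  using free[of z x "f z - x"] assms by auto

lemma shift_up:
  assumes "L \<le> s" "L \<le> t" "\<chi> s \<noteq> \<chi> t" "f s < f t" "1 \<le> x" "x < f s" "\<chi> x = \<chi> s"
  shows "\<chi> (x + (f t - f s)) = \<chi> s"
proof -
  have "\<chi> (f s - x) = \<chi> t" using flip[of s x] assms by auto
  then have "\<chi> (f t - (f s - x)) \<noteq> \<chi> t" using flip[of t "f s - x"] assms by auto
  moreover have "f t - (f s - x) = x + (f t - f s)" using assms by simp
  ultimately show ?thesis using assms by simp
qed

text \<open>The bound \<open>f s - f t < x\<close> keeps \<open>f s - x\<close> below
  \<open>f t\<close>, so the second reflection is legitimate.\<close>

lemma shift_down:
  assumes "L \<le> s" "L \<le> t" "\<chi> s \<noteq> \<chi> t" "f t < f s" "f s - f t < x" "x < f s" "\<chi> x = \<chi> s"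
  shows "\<chi> (x - (f s - f t)) = \<chi> s"
proof -
  have "\<chi> (f s - x) = \<chi> t" using flip[of s x] assms by auto
  then have "\<chi> (f t - (f s - x)) \<noteq> \<chi> t" using flip[of t "f s - x"] assms by auto
  moreover have "f t - (f s - x) = x - (f s - f t)" using assms by simp
  ultimately show ?thesis using assms by simp
qed

lemma shift_up_multiple:
  assumes "L \<le> s" "L \<le> t" "\<chi> s \<noteq> \<chi> t" "f s < f t" "1 \<le> x" "\<chi> x = \<chi> s"
    and "x + k * (f t - f s) < f t"
  shows "\<chi> (x + k * (f t - f s)) = \<chi> s"
  using assms(7)
proof (induction k)
  case (Suc k)
  \<comment> \<open>A number below \<open>f t\<close> after one more translation was below
    \<open>f s\<close> before it.\<close>
  have "x + k * (f t - f s) < f s" using Suc.prems assms(4) by simp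
  then show ?case using shift_up[of s t "x + k * (f t - f s)"] Suc assms by (simp add: add_ac)
qed (use assms in simp)

lemma opposite_switches_far_apart:
  assumes z: "L \<le> z" "\<chi> z \<noteq> \<chi> (Suc z)"
    and w: "z < w" "\<chi> w = \<chi> (Suc z)" "\<chi> (Suc w) = \<chi> z"
  shows "4 * z < w"
proof (rule ccontr)
  assume "\<not> 4 * z < w"
  define a where "a = f (Suc z) - f z"
  define b where "b = f (Suc w) - f w"
  define g where "g = gcd a b"
  have a: "0 < a" "f (Suc z) = f z + a" using incr[OF z(1)] by (auto simp: a_def)
  have b: "0 < b" "f (Suc w) = f w + b" using incr[of w] z(1) w(1) by (auto simp: b_def)
  have bz: "2 * b < f z"
    unfolding b_def by (rule slow) (use z(1) w(1) \<open>\<not> 4 * z < w\<close> in simp_all)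
  have zw: "f (Suc z) \<le> f w"
    using f_less[of "Suc z" w] z(1) w(1) by (cases "Suc z = w") auto
  \<comment> \<open>The colour of \<open>z\<close> is moved by \<open>a\<close> through the pair
    \<open>z\<close>, \<open>Suc z\<close>, and by \<open>-b\<close> through the pair
    \<open>Suc w\<close>, \<open>w\<close>, since \<open>Suc w\<close> has the colour of
    \<open>z\<close>.\<close>
  have base: "\<chi> y = \<chi> x"
    if "1 \<le> x" "x \<le> a + b" "1 \<le> y" "y \<le> a + b" "[x = y] (mod g)" "\<chi> x = \<chi> z" for x y
  proof -
    have "y \<in> {x. \<chi> x = \<chi> z}"
    proof (rule rotation_closed[of a b _ x])
      show "x + a \<in> {x. \<chi> x = \<chi> z}" if "x \<in> {x. \<chi> x = \<chi> z}" "1 \<le> x" "x \<le> b" for x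
        using shift_up[of z "Suc z" x] that z a bz by simp
      show "x - b \<in> {x. \<chi> x = \<chi> z}" if "x \<in> {x. \<chi> x = \<chi> z}" "b < x" "x \<le> a + b" for x
        using shift_down[of "Suc w" w x] that z w a b bz zw by simp
    qed (use that a b in \<open>auto simp: g_def\<close>)
    then show ?thesis using that by simp
  qed
  have g: "0 < g" "g \<le> a" "g \<le> b" "g dvd a" "g dvd b"
    unfolding g_def using a b by (auto intro: gcd_le1_nat gcd_le2_nat)
  have rep: "\<exists>r k. 1 \<le> r \<and> r \<le> m \<and> y = r + k * m" if "0 < m" "1 \<le> y" for y m :: nat
    using that by (intro exI[of _ "(y - 1) mod m + 1"] exI[of _ "(y - 1) div m"])
      (auto simp: Suc_le_eq)
  \<comment> \<open>Each colour climbs by its own step: \<open>a\<close> for the colour of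
    \<open>z\<close>, \<open>b\<close> for that of \<open>w\<close>. So \<open>y\<close> is reached
    from its representative in \<open>{1..a}\<close> or \<open>{1..b}\<close>, which
    \<open>base\<close> compares with \<open>x\<close>.\<close>
  have periodic_small: "\<chi> y = \<chi> x"
    if x: "1 \<le> x" "x \<le> g" and y: "1 \<le> y" "y < f (Suc z)" and xy: "[x = y] (mod g)" for x y
  proof (cases "\<chi> x = \<chi> z")
    case True
    obtain r k where r: "1 \<le> r" "r \<le> a" "y = r + k * a" using rep[of a y] a y by blast
    have "[y = r] (mod g)" using r(3) g by (simp add: cong_add_lcancel_0_nat cong_0_iff)
    then have "\<chi> r = \<chi> x" using base[of x r] r x g True xy cong_trans by auto
    then show ?thesis using shift_up_multiple[of z "Suc z" r k] r y z a True by simp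
  next
    case False
    obtain r k where r: "1 \<le> r" "r \<le> b" "y = r + k * b" using rep[of b y] b y by blast
    have "[y = r] (mod g)" using r(3) g by (simp add: cong_add_lcancel_0_nat cong_0_iff)
    then have "[r = y] (mod g)" by (rule cong_sym)
    then have "\<chi> r = \<chi> x"
      using base[of r x] r x g False xy cong_trans cong_sym by (metis add.commute trans_le_add1 order_trans)
    then show ?thesis using shift_up_multiple[of w "Suc w" r k] r y z w b zw False by simp
  qed
  have periodic: "\<chi> x = \<chi> y"
    if xy: "1 \<le> x" "x < f (Suc z)" "1 \<le> y" "y < f (Suc z)" "[x = y] (mod g)" for x y
  proof -
    obtain r k where r: "1 \<le> r" "r \<le> g" "x = r + k * g" using rep[of g x] g xy by blast
    have "[r = x] (mod g)" using r by (auto simp: cong_def)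
    then show ?thesis using periodic_small[of r] r xy cong_trans by metis
  qed
  have "\<exists>h. 2 * h = f z \<or> 2 * h = f z + g"
  proof (cases "even (f z)")
    case True
    then show ?thesis by (metis evenE)
  next
    case False
    \<comment> \<open>Here \<open>f (Suc z)\<close> is even, so the difference \<open>a\<close> and
      its divisor \<open>g\<close> are odd.\<close>
    then have "odd a" using parity[of z] z a by simp
    then have "odd g" using g by auto
    then show ?thesis using False by (metis even_add evenE)
  qed
  then obtain h where h: "2 * h = f z \<or> 2 * h = f z + g" by blast
  have hz: "1 \<le> h" "h < f z" using h g bz by auto
  have "[f z - h = h] (mod g)"
  proof -
    have "f z - h = h \<or> h = (f z - h) + g" using h hz by auto
    then show ?thesis by (metis cong_add_rcancel_0_nat cong_refl cong_def mod_add_self2)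
  qed
  moreover have "[f (Suc z) - h = f z - h] (mod g)"
  proof -
    have "f (Suc z) - h = (f z - h) + a" using hz a by simp
    then show ?thesis using g by (simp add: cong_add_lcancel_0_nat cong_0_iff)
  qed
  ultimately have "[f z - h = h] (mod g)" "[f (Suc z) - h = h] (mod g)"
    using cong_trans by blast+
  then have "\<chi> (f z - h) = \<chi> h" "\<chi> (f (Suc z) - h) = \<chi> h"
    using periodic[of "f z - h" h] periodic[of "f (Suc z) - h" h] hz a by auto
  then show False
    using flip[of z h] flip[of "Suc z" h] z hz a by auto
qed

lemma switch_beyond: "\<exists>z \<ge> n. \<chi> z \<noteq> \<chi> (Suc z)"
proof (rule ccontr)
  assume *: "\<not> ?thesis"
  define m where "m = n + L + 1"
  have const: "\<chi> k = \<chi> m" if "m \<le> k" for k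
    using that
  proof (induction rule: dec_induct)
    case (step k)
    have "n \<le> k" using step.hyps by (simp add: m_def)
    then have "\<chi> k = \<chi> (Suc k)" using * by blast
    then show ?case using step.IH by simp
  qed simp
  \<comment> \<open>Then \<open>f ?z \<ge> 2 * m\<close>, so \<open>m\<close> and
    \<open>f ?z - m\<close> both lie in the constant tail.\<close>
  let ?z = "L + 2 * m"
  have "m \<le> f ?z - m" "m < f ?z" using le_iterate[of "2 * m"] by (auto simp: m_def)
  then show False
    using free[of ?z m "f ?z - m"] const[of ?z] const[of "f ?z - m"] by (auto simp: m_def)
qed

text \<open>Another colour at \<open>x\<close> would force a switch \<open>u\<close> into the colour
  of \<open>v\<close> with \<open>x \<le> u < v\<close>. It is opposite to the switch at
  \<open>v\<close>, yet \<open>v \<le> 4 * u\<close>.\<close>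

lemma block_constant:
  assumes "\<chi> v \<noteq> \<chi> (Suc v)" "L \<le> x" "x \<le> v" "v \<le> 4 * x"
  shows "\<chi> x = \<chi> v"
proof (rule ccontr)
  assume "\<chi> x \<noteq> \<chi> v"
  from switch_between[of x v \<chi>, OF assms(3) this]
  obtain u where u: "x \<le> u" "u < v" "\<chi> u \<noteq> \<chi> v" "\<chi> (Suc u) = \<chi> v"
    by blast
  have "4 * u < v"
    by (rule opposite_switches_far_apart) (use u assms in simp_all)
  then show False using u assms by simp
qed

lemma inconsistent: False
proof -
  obtain n where n: "n \<ge> 1" "\<chi> n \<noteq> \<chi> (Suc n)" using switch_beyond by blast
  define K where "K = Suc n"
  have both: "\<exists>x. 1 \<le> x \<and> x \<le> K \<and> \<chi> x = c" for c
    using n unfolding K_def by (metis le_SucI le_refl le_add1 plus_1_eq_Suc)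
  \<comment> \<open>The margin \<open>4 * K\<close> keeps halves of numbers up to
    \<open>f (Suc z)\<close>, itself below 3/2 of \<open>f z\<close>, under \<open>f z - K\<close>;
    \<open>4 * L\<close> keeps halves of numbers from \<open>f z\<close> on above
    \<open>L\<close>.\<close>
  obtain z where z: "z \<ge> L + (4 * K + 4 * L + 8)" "\<chi> z \<noteq> \<chi> (Suc z)"
    using switch_beyond by blast
  have Lz: "L \<le> z" using z by simp
  have large: "4 * K + 4 * L + 8 \<le> f z"
    using le_iterate[of "z - L"] z by simp
  have next_le: "f z < f (Suc z)" "2 * f (Suc z) < 3 * f z"
    using incr[of z] slow[of z z] Lz by auto
  obtain x y where x: "1 \<le> x" "x \<le> K" "\<chi> x = \<chi> z" and y: "1 \<le> y" "y \<le> K" "\<chi> y = \<chi> (Suc z)"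
    using both by metis
  define P where "P = f z - x"
  define Q where "Q = f (Suc z) - y"
  have PQ: "\<chi> P \<noteq> \<chi> Q"
    using flip[of z x] flip[of "Suc z" y] Lz x y z large next_le by (auto simp: P_def Q_def)
  \<comment> \<open>The order of \<open>P\<close> and \<open>Q\<close> is unknown, as
    \<open>y - x\<close> may exceed \<open>f (Suc z) - f z\<close>.\<close>
  have "\<exists>v. min P Q \<le> v \<and> v < max P Q \<and> \<chi> v \<noteq> \<chi> (Suc v)"
  proof (cases "P \<le> Q")
    case True
    then show ?thesis using switch_between[of P Q \<chi>] PQ by (auto simp: max_def min_def)
  next
    case False
    then show ?thesis using switch_between[of Q P \<chi>] PQ by (auto simp: max_def min_def)
  qed
  then obtain v where v: "min P Q \<le> v" "v < max P Q" "\<chi> v \<noteq> \<chi> (Suc v)" by blast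
  have vz: "f z - K \<le> v" "v < f (Suc z)"
    using v x y next_le large by (auto simp: P_def Q_def)
  have half: "\<chi> v \<noteq> \<chi> t" if t: "L \<le> t" "f z \<le> f t" "f t \<le> f (Suc z)" for t
  proof
    assume eq: "\<chi> v = \<chi> t"
    define h where "h = f t div 2"
    have h: "2 * h \<le> f t" "f t \<le> 2 * h + 1" by (auto simp: h_def)
    have "\<chi> h = \<chi> v"
      by (rule block_constant[OF v(3)]) (use h t vz next_le large in linarith)+
    moreover have "\<chi> (f t - h) = \<chi> v"
      by (rule block_constant[OF v(3)]) (use h t vz next_le large in linarith)+
    ultimately show False
      using free[OF t(1), of h "f t - h"] eq h t(2) large by linarith
  qed
  have "\<chi> v \<noteq> \<chi> z" "\<chi> v \<noteq> \<chi> (Suc z)"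
    by (rule half; use Lz next_le in simp)+
  then show False using z(2) by blast
qed

end

section \<open>Growth of integer polynomials\<close>

lemma abs_poly_le:
  fixes q :: "int poly"
  assumes "degree q \<le> m"
  obtains C where "0 \<le> C" "\<And>x. 1 \<le> x \<Longrightarrow> \<bar>poly q x\<bar> \<le> C * x ^ m"
proof
  show "0 \<le> (\<Sum>i\<le>degree q. \<bar>coeff q i\<bar>)" by (simp add: sum_nonneg)
  fix x :: int assume x: "1 \<le> x"
  have "\<bar>poly q x\<bar> \<le> (\<Sum>i\<le>degree q. \<bar>coeff q i * x ^ i\<bar>)"
    unfolding poly_altdef by (rule sum_abs)
  also have "\<dots> \<le> (\<Sum>i\<le>degree q. \<bar>coeff q i\<bar> * x ^ m)"
    using x assms by (intro sum_mono) (auto simp: abs_mult intro!: mult_left_mono power_increasing)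
  finally show "\<bar>poly q x\<bar> \<le> (\<Sum>i\<le>degree q. \<bar>coeff q i\<bar>) * x ^ m"
    by (simp add: sum_distrib_right)
qed

text \<open>A positive integer leading coefficient is at least 1, and the lower terms are bounded by
  a multiple of the next power.\<close>

lemma poly_ge:
  fixes p :: "int poly"
  assumes "1 \<le> degree p" "0 < lead_coeff p"
  obtains R where "0 \<le> R" "\<And>x. 1 \<le> x \<Longrightarrow> (x - R) * x ^ (degree p - 1) \<le> poly p x"
proof -
  define m where "m = degree p - 1"
  have d: "degree p = Suc m" using assms by (simp add: m_def)
  define r where "r = p - monom (lead_coeff p) (degree p)"
  have "degree r \<le> m"
    unfolding r_def d
    by (rule degree_le) (use d in \<open>auto simp: coeff_eq_0 not_less_eq_eq less_Suc_eq_le le_less_Suc_eq\<close>)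
  then obtain R where R: "0 \<le> R" "\<And>x. 1 \<le> x \<Longrightarrow> \<bar>poly r x\<bar> \<le> R * x ^ m" using abs_poly_le by blast
  have "(x - R) * x ^ m \<le> poly p x" if x: "1 \<le> x" for x
  proof -
    have "poly p x = lead_coeff p * x ^ Suc m + poly r x" by (simp add: r_def poly_monom d)
    moreover have "1 * x ^ Suc m \<le> lead_coeff p * x ^ Suc m"
      using assms x by (intro mult_right_mono) auto
    moreover have "- (R * x ^ m) \<le> poly r x" using R(2)[OF x] by linarith
    ultimately show ?thesis by (simp add: algebra_simps)
  qed
  then show ?thesis using that R(1) unfolding m_def by blast
qed

lemma poly_eventually_pos:
  fixes q :: "int poly"
  assumes "0 < lead_coeff q"
  shows "\<exists>L. \<forall>x\<ge>L. 0 < poly q x"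
proof (cases "1 \<le> degree q")
  case True
  obtain R where R: "0 \<le> R" "\<And>x. 1 \<le> x \<Longrightarrow> (x - R) * x ^ (degree q - 1) \<le> poly q x"
    using poly_ge[OF True assms] by blast
  have "0 < poly q x" if "x \<ge> R + 1" for x
  proof -
    have "0 < (x - R) * x ^ (degree q - 1)" using that R(1) by simp
    also have "\<dots> \<le> poly q x" using R that by simp
    finally show ?thesis .
  qed
  then show ?thesis by blast
next
  case False
  then obtain c where "q = [:c:]" using degree_eq_zeroE[of q] by auto
  then show ?thesis using assms by auto
qed

lemma poly_eventual_sign:
  fixes q :: "int poly"
  shows "\<exists>L. (\<forall>x\<ge>L. 0 < poly q x) \<or> (\<forall>x\<ge>L. poly q x \<le> 0)"
proof (cases "lead_coeff q" "0 :: int" rule: linorder_cases)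
  case less
  then have "0 < lead_coeff (- q)" by simp
  then obtain L where "\<forall>x\<ge>L. 0 < poly (- q) x" using poly_eventually_pos by blast
  then have "\<forall>x\<ge>L. poly q x \<le> 0" by (auto simp: less_imp_le)
  then show ?thesis by blast
next
  case equal
  then show ?thesis by simp
next
  case greater
  then show ?thesis using poly_eventually_pos by blast
qed

text \<open>The difference polynomial has an eventual sign. Were it nonpositive, \<open>p\<close>
  would be bounded above, although \<open>p\<close> minus any constant is eventually
  positive.\<close>

lemma poly_eventually_increasing:
  fixes p :: "int poly"
  assumes "1 \<le> degree p" "0 < lead_coeff p"
  shows "\<exists>L. \<forall>x\<ge>L. poly p x < poly p (x + 1)"
proof -
  define q where "q = pcompose p [:1, 1:] - p"
  have q: "poly q x = poly p (x + 1) - poly p x" for x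
    by (simp add: q_def poly_pcompose add.commute)
  obtain L where L: "(\<forall>x\<ge>L. 0 < poly q x) \<or> (\<forall>x\<ge>L. poly q x \<le> 0)"
    using poly_eventual_sign by blast
  have "\<not> (\<forall>x\<ge>L. poly q x \<le> 0)"
  proof
    assume *: "\<forall>x\<ge>L. poly q x \<le> 0"
    have bound: "poly p x \<le> poly p L" if "L \<le> x" for x
      using that
    proof (induction rule: int_ge_induct)
      case (step i)
      then show ?case using *[rule_format, of i] q[of i] by simp
    qed simp
    have "0 < lead_coeff (p - [:poly p L:])" "1 \<le> degree (p - [:poly p L:])"
    proof -
      have "degree (p - [:poly p L:]) = degree p"
        using degree_add_eq_left[of "- [:poly p L:]" p] assms by (simp add: diff_conv_add_uminus del: add_uminus_conv_diff)
      then show "0 < lead_coeff (p - [:poly p L:])" "1 \<le> degree (p - [:poly p L:])"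
        using assms by (auto simp: coeff_pCons split: nat.splits)
    qed
    then obtain M where "\<forall>x\<ge>M. 0 < poly (p - [:poly p L:]) x"
      using poly_eventually_pos by blast
    then have "poly p L < poly p (max L M)" by (auto dest: spec[of _ "max L M"])
    then show False using bound[of "max L M"] by linarith
  qed
  then show ?thesis using L q by auto
qed

text \<open>Substituting \<open>x + 1\<close> preserves the leading coefficient, so the top terms
  cancel.\<close>

lemma abs_poly_diff_le:
  fixes p :: "int poly"
  assumes "1 \<le> degree p"
  obtains C where "0 \<le> C"
    "\<And>x. 1 \<le> x \<Longrightarrow> \<bar>poly p (x + 1) - poly p x\<bar> \<le> C * x ^ (degree p - 1)"
proof -
  define q where "q = pcompose p [:1, 1:] - p"
  have "degree q \<le> degree p - 1"
  proof (rule degree_le, intro allI impI)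
    fix i assume i: "degree p - 1 < i"
    have "coeff (pcompose p [:1, 1:]) (degree p) = coeff p (degree p)"
      using lead_coeff_comp[of "[:1, 1:]" p] by (simp add: degree_pcompose)
    then show "coeff q i = 0"
      using i by (cases "i = degree p") (auto simp: q_def coeff_eq_0 degree_pcompose)
  qed
  then show ?thesis
    using abs_poly_le[of q] that by (auto simp: q_def poly_pcompose add.commute)
qed

lemma poly_slow_growth:
  fixes p :: "int poly"
  assumes "1 \<le> degree p" "0 < lead_coeff p"
  shows "\<exists>L. \<forall>u\<ge>L. \<forall>v\<ge>u. v \<le> 4 * u \<longrightarrow> 2 * (poly p (v + 1) - poly p v) < poly p u"
proof -
  define m where "m = degree p - 1"
  obtain R where R: "0 \<le> R" "\<And>x. 1 \<le> x \<Longrightarrow> (x - R) * x ^ m \<le> poly p x"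
    using poly_ge[OF assms] unfolding m_def by blast
  obtain C where C: "0 \<le> C" "\<And>x. 1 \<le> x \<Longrightarrow> \<bar>poly p (x + 1) - poly p x\<bar> \<le> C * x ^ m"
    using abs_poly_diff_le[OF assms(1)] unfolding m_def by blast
  \<comment> \<open>The summand \<open>2 * C * 4 ^ m\<close> absorbs twice the bound
    \<open>C * (4 * u) ^ m\<close> on the difference at \<open>v \<le> 4 * u\<close>.\<close>
  define L where "L = R + 2 * C * 4 ^ m + 1"
  have "2 * (poly p (v + 1) - poly p v) < poly p u" if "L \<le> u" "u \<le> v" "v \<le> 4 * u" for u v
  proof -
    have "1 \<le> L" using R(1) C(1) by (simp add: L_def)
    then have pos: "1 \<le> u" "1 \<le> v" using that by auto
    have "v ^ m \<le> (4 * u) ^ m" using that pos by (intro power_mono) auto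
    then have "C * v ^ m \<le> C * (4 * u) ^ m" using C(1) by (rule mult_left_mono)
    then have "2 * (poly p (v + 1) - poly p v) \<le> (2 * C * 4 ^ m) * u ^ m"
      using C(2)[OF pos(2)] by (simp add: power_mult_distrib)
    also have "\<dots> < (u - R) * u ^ m"
      using that pos by (intro mult_strict_right_mono) (auto simp: L_def)
    also have "\<dots> \<le> poly p u" using R(2) pos by simp
    finally show ?thesis .
  qed
  then show ?thesis by blast
qed

section \<open>Parity of the values and the two directions\<close>

lemma even_poly_add_2: "even (poly p (x + 2)) \<longleftrightarrow> even (poly p x)" for p :: "int poly"
  by (induction p) auto

text \<open>The parity of a value depends on that of the argument, and any two consecutive arguments
  cover both parities.\<close>

lemma even_poly_mult_Suc:
  fixes p :: "int poly"
  shows "even (poly p (int n) * poly p (int (Suc n))) \<longleftrightarrow> even (poly p 1 * poly p 2)"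
proof (induction n)
  case 0
  then show ?case using even_poly_add_2[of p 0] by auto
next
  case (Suc n)
  have "int (Suc (Suc n)) = int n + 2" by simp
  then show ?case using Suc even_poly_add_2[of p "int n"] by (metis even_mult_iff)
qed

lemma infinite_mono_solutions:
  fixes p :: "int poly"
  assumes deg: "1 \<le> degree p" and lead: "0 < lead_coeff p"
    and ev: "even (poly p 1 * poly p 2)" and col: "two_colouring \<phi>"
  shows "infinite (mono_solutions p \<phi>)"
proof
  assume "finite (mono_solutions p \<phi>)"
  then have "finite ((\<lambda>(x, y, z). z) ` mono_solutions p \<phi>)" by simp
  then obtain M where M: "\<And>x y z. (x, y, z) \<in> mono_solutions p \<phi> \<Longrightarrow> z < M"
    unfolding finite_nat_set_iff_bounded by force
  obtain A where A: "\<forall>x\<ge>A. 0 < poly p x" using poly_eventually_pos lead by blast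
  obtain B where B: "\<forall>x\<ge>B. poly p x < poly p (x + 1)"
    using poly_eventually_increasing deg lead by blast
  obtain D where D: "\<forall>u\<ge>D. \<forall>v\<ge>u. v \<le> 4 * u \<longrightarrow> 2 * (poly p (v + 1) - poly p v) < poly p u"
    using poly_slow_growth deg lead by blast
  \<comment> \<open>\<open>M\<close> rules out solutions with \<open>z \<ge> L\<close>, and
    \<open>+ 1\<close> keeps \<open>z\<close> away from 0, where the colour is
    unconstrained.\<close>
  define L where "L = M + nat A + nat B + nat D + 1"
  define f where "f n = nat (poly p (int n))" for n
  have f: "int (f n) = poly p (int n)" "poly p (int n) < poly p (int n + 1)" if "L \<le> n" for n
    using A[rule_format, of "int n"] B[rule_format, of "int n"] that unfolding f_def L_def by linarith+
  have fS: "int (f (Suc n)) = poly p (int n + 1)" if "L \<le> n" for n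
    using f(1)[of "Suc n"] that by (simp add: add.commute)
  have "solution_free (\<lambda>n. \<phi> n = 1) f L"
  proof
    fix x y z
    assume *: "L \<le> z" "1 \<le> x" "1 \<le> y" "x + y = f z" "(\<phi> x = 1) = (\<phi> z = 1)" "(\<phi> y = 1) = (\<phi> z = 1)"
    have pm: "\<phi> n = 1 \<or> \<phi> n = - 1" if "1 \<le> n" for n
      using col that by (auto simp: two_colouring_def)
    have "1 \<le> z" using * by (simp add: L_def)
    then have "\<phi> x = \<phi> y" "\<phi> y = \<phi> z" using * pm[of x] pm[of y] pm[of z] by auto
    moreover have "int x + int y = poly p (int z)" using * f(1) by (metis of_nat_add)
    ultimately have "(x, y, z) \<in> mono_solutions p \<phi>"
      using * \<open>1 \<le> z\<close> by (simp add: mono_solutions_def)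
    from M[OF this] show False using *(1) by (simp add: L_def)
  next
    fix n assume "L \<le> n"
    then show "f n < f (Suc n)" using f[of n] fS[of n] by linarith
  next
    fix u v assume uv: "L \<le> u" "u \<le> v" "v \<le> 4 * u"
    have "2 * (poly p (int v + 1) - poly p (int v)) < poly p (int u)"
      using D[rule_format, of "int u" "int v"] uv by (simp add: L_def)
    then show "2 * (f (Suc v) - f v) < f u"
      using f(1)[of u] f[of v] fS[of v] uv by (simp add: of_nat_diff flip: of_nat_less_iff[where ?'a = int])
  next
    fix n assume "L \<le> n"
    then show "even (f n) \<or> even (f (Suc n))"
      using even_poly_mult_Suc[of p n] ev f(1)[of n] f(1)[of "Suc n"]
      by (metis even_mult_iff even_of_nat le_SucI)
  qed
  then show False by (rule solution_free.inconsistent)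
qed

lemma parity_colouring_mono_solutions:
  fixes p :: "int poly"
  assumes "odd (poly p 1 * poly p 2)"
  shows "mono_solutions p (\<lambda>n. if even n then 1 else - 1) = {}"
proof -
  have "odd (poly p (int z))" for z
    using even_poly_mult_Suc[of p z] assms by auto
  moreover have "even (poly p (int z))"
    if "int x + int y = poly p (int z)" "even x = even y" for x y z
    using that by (metis even_add even_of_nat)
  moreover have "even x = even y"
    if "(if even x then 1 else - 1 :: int) = (if even y then 1 else - 1)" for x y :: nat
    using that by (simp split: if_splits)
  ultimately show ?thesis
    unfolding mono_solutions_def by blast
qed

theorem corollary1p4:
  fixes p :: "int poly"
  assumes "degree p \<ge> 1"
    and "lead_coeff p > 0"
  shows "(\<forall>\<phi>. two_colouring \<phi> \<longrightarrow> infinite (mono_solutions p \<phi>)) \<longleftrightarrow>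
           even (poly p 1 * poly p 2)"
proof
  assume *: "\<forall>\<phi>. two_colouring \<phi> \<longrightarrow> infinite (mono_solutions p \<phi>)"
  have "two_colouring (\<lambda>n. if even n then 1 else - 1)" by (simp add: two_colouring_def)
  then show "even (poly p 1 * poly p 2)"
    using * parity_colouring_mono_solutions[of p] by fastforce
next
  assume "even (poly p 1 * poly p 2)"
  then show "\<forall>\<phi>. two_colouring \<phi> \<longrightarrow> infinite (mono_solutions p \<phi>)"
    using infinite_mono_solutions assms by blast
qed

end
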